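(* Let $d\ge1$, $1\le p<\infty$, and let $\nu:\mathbb{R}^d\setminus\{0\}\to[0,\infty)$ be measurable. Let $w(r)=(r\,\nu^\#(r))^{1/p}$ be the potential associated with $\nu$ (see context). Assume that $r\mapsto w(r)$ is invertible from $[0,\infty)$ to $[0,\infty)$, that $t\mapsto\phi(t^{1/p})$ is a Young function, where $\phi(t)=1/w^{-1}(1/t)$, and that there is $\theta>0$ such that $\phi(\theta s/t)\le\phi(s)/\phi(t)$ for all $0\le s\le t$, $t>0$. Let $\Omega\subset\mathbb{R}^d$ be measurable with $0<|\Omega|<\infty$. If the Poincaré–Sobolev inequality holds on $\Omega$, i.e. there is a constant $C>0$ with $$\Big\|u-\frac1{|\Omega|}\int_\Omega u\Big\|_{L^\phi(\Omega)}\le C\Big(\int_\Omega\int_\Omega|u(x)-u(y)|^p\nu(x-y)\,dy\,dx\Big)^{1/p}\quad\text{for all }u\in L^\phi(\Omega),$$ then the Poincaré inequality also holds on $\Omega$, i.e. there is a constant $C'>0$ with $$\Big\|u-\frac1{|\Omega|}\int_\Omega u\Big\|_{L^p(\Omega)}\le C'\Big(\int_\Omega\int_\Omega|u(x)-u(y)|^p\nu(x-y)\,dy\,dx\Big)^{1/p}\quad\text{for all }u\in L^p(\Omega).$$ The converse holds true if in addition $\Omega$ is a $W^p_\nu$-extension domain: in that case the Poincaré inequality on $\Omega$ (for some constant) implies the Poincaré–Sobolev inequality on $\Omega$ (for some constant).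
   Context: $|E|$ is Lebesgue measure, $c_d=|B(0,1)|$, $\eta(r)=(r/c_d)^{1/d}$. The symmetric decreasing rearrangement of $\nu$ is the radial function $\nu^*(\rho)=\inf\{s>0:|\{\nu>s\}|\le c_d\rho^d\}$, $\rho\ge0$. Define $\nu^\#(r)=\int_{\{\nu<\nu^*(\eta(r))\}}\nu(h)\,dh$, $w(r)=(r\,\nu^\#(r))^{1/p}$ for $r>0$, $w(0)=0$, and $\phi(t)=1/w^{-1}(1/t)$ for $t>0$, $\phi(0)=0$. A Young function is a convex function $\phi:[0,\infty]\to[0,\infty]$ with $\phi(0)=0$, not identically $0$ and not identically $\infty$ on $(0,\infty)$. $L^\phi(\Omega)$ is the Orlicz space of measurable $u:\Omega\to\mathbb{R}$ with $\int_\Omega\phi(|u|/\lambda)\,dx<\infty$ for some $\lambda>0$, with Luxemburg norm $\|u\|_{L^\phi(\Omega)}=\inf\{\lambda>0:\int_\Omega\phi(|u|/\lambda)\,dx\le1\}$. For $\Omega$ open, $W^p_\nu(\Omega)=\{u\in L^p(\Omega):\int_\Omega\int_\Omega|u(x)-u(y)|^p\nu(x-y)\,dy\,dx<\infty\}$ with norm $\|u\|_{W^p_\nu(\Omega)}=\big(\|u\|^p_{L^p(\Omega)}+\int_\Omega\int_\Omega|u(x)-u(y)|^p\nu(x-y)\,dy\,dx\big)^{1/p}$. An open set $\Omega\subset\mathbb{R}^d$ is a $W^p_\nu$-extension domain if there are a linear operator $E:W^p_\nu(\Omega)\to W^p_\nu(\mathbb{R}^d)$ and a constant $C=C(\Omega,\nu,d,p)$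 such that $Eu|_\Omega=u$ and $\|Eu\|_{W^p_\nu(\mathbb{R}^d)}\le C\|u\|_{W^p_\nu(\Omega)}$ for all $u\in W^p_\nu(\Omega)$. Constants are generic: they do not depend on $u$ and need not coincide in the two inequalities. Right-hand sides may be $+\infty$. *)

theory Defs
  imports "HOL-Analysis.Analysis"
begin

text \<open>
  The space is a Euclidean space \<open>'a\<close> of dimension \<open>d = DIM('a)\<close>; integrals, measurability and
  almost-everywhere statements refer to the (complete) Lebesgue measure. A kernel is given as
  \<open>\<nu> :: 'a \<Rightarrow> real\<close>, of which only the values away from \<open>0\<close> are used. Likewise a function on
  \<open>\<Omega>\<close> is a total function of which only the values on \<open>\<Omega>\<close> are used. Quantities that may be
  \<open>\<infinity>\<close> have type \<^typ>\<open>ennreal\<close>.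
\<close>

text \<open>The power \<open>x\<^sup>a\<close> on \<open>[0,\<infinity>]\<close>; only meant for exponents \<open>a > 0\<close>, where \<open>\<infinity>\<^sup>a = \<infinity>\<close>.\<close>

definition epowr :: "ennreal \<Rightarrow> real \<Rightarrow> ennreal" where
  "epowr x a = (if x = top then top else ennreal (enn2real x powr a))"

definition unit_ball_measure :: "'a::euclidean_space itself \<Rightarrow> real" where
  "unit_ball_measure _ = measure lebesgue (ball (0::'a) 1)"

definition eta :: "'a::euclidean_space itself \<Rightarrow> real \<Rightarrow> real" where
  "eta T r = (r / unit_ball_measure T) powr (1 / real DIM('a))"

text \<open>Radial profile of the symmetric decreasing rearrangement; the infimum of the empty set is \<open>\<infinity>\<close>.\<close>

definition rearrangement :: "('a::euclidean_space \<Rightarrow> real) \<Rightarrow> real \<Rightarrow> ennreal" where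
  "rearrangement \<nu> \<rho> =
     Inf {ennreal s | s. 0 < s \<and>
       emeasure lebesgue {h. h \<noteq> 0 \<and> \<nu> h > s}
         \<le> ennreal (unit_ball_measure TYPE('a) * \<rho> ^ DIM('a))}"

definition nu_sharp :: "('a::euclidean_space \<Rightarrow> real) \<Rightarrow> real \<Rightarrow> ennreal" where
  "nu_sharp \<nu> r =
     (\<integral>\<^sup>+ h \<in> {h. h \<noteq> 0 \<and> ennreal (\<nu> h) < rearrangement \<nu> (eta TYPE('a) r)}. ennreal (\<nu> h) \<partial>lebesgue)"

definition potential :: "real \<Rightarrow> ('a::euclidean_space \<Rightarrow> real) \<Rightarrow> real \<Rightarrow> ennreal" where
  "potential p \<nu> r = (if r = 0 then 0 else epowr (ennreal r * nu_sharp \<nu> r) (1 / p))"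

text \<open>
  In \<^typ>\<open>ennreal\<close>, \<open>{..<top}\<close> is \<open>[0,\<infinity>)\<close>: in particular the potential takes finite values only.
\<close>

definition potential_invertible :: "real \<Rightarrow> ('a::euclidean_space \<Rightarrow> real) \<Rightarrow> bool" where
  "potential_invertible p \<nu> \<longleftrightarrow> bij_betw (potential p \<nu>) {0..} {..<top}"

definition potential_inv :: "real \<Rightarrow> ('a::euclidean_space \<Rightarrow> real) \<Rightarrow> ennreal \<Rightarrow> real" where
  "potential_inv p \<nu> = the_inv_into {0..} (potential p \<nu>)"

text \<open>
  At \<open>t = \<infinity>\<close> the formula reads \<open>1 / w\<^sup>-\<^sup>1(0) = 1 / 0 = \<infinity>\<close> by the conventions of \<^typ>\<open>ennreal\<close>,
  which is the usual extension to \<open>[0,\<infinity>]\<close>.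
\<close>

definition phi :: "real \<Rightarrow> ('a::euclidean_space \<Rightarrow> real) \<Rightarrow> ennreal \<Rightarrow> ennreal" where
  "phi p \<nu> t = (if t = 0 then 0 else 1 / ennreal (potential_inv p \<nu> (1 / t)))"

definition young_function :: "(ennreal \<Rightarrow> ennreal) \<Rightarrow> bool" where
  "young_function \<Phi> \<longleftrightarrow>
     (\<forall>x y. \<forall>a\<in>{0..1}. \<Phi> (ennreal (1 - a) * x + ennreal a * y)
                        \<le> ennreal (1 - a) * \<Phi> x + ennreal a * \<Phi> y) \<and>
     \<Phi> 0 = 0 \<and>
     (\<exists>t. 0 < t \<and> t < top \<and> \<Phi> t \<noteq> 0) \<and>
     (\<exists>t. 0 < t \<and> t < top \<and> \<Phi> t \<noteq> top)"

definition orlicz_space :: "(ennreal \<Rightarrow> ennreal) \<Rightarrow> 'a::euclidean_space set \<Rightarrow> ('a \<Rightarrow> real) set" where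
  "orlicz_space \<Phi> \<Omega> =
     {u \<in> borel_measurable (lebesgue_on \<Omega>).
       \<exists>c>0. (\<integral>\<^sup>+ x. \<Phi> (ennreal (\<bar>u x\<bar> / c)) \<partial>lebesgue_on \<Omega>) < top}"

definition luxemburg_norm :: "(ennreal \<Rightarrow> ennreal) \<Rightarrow> 'a::euclidean_space set \<Rightarrow> ('a \<Rightarrow> real) \<Rightarrow> ennreal" where
  "luxemburg_norm \<Phi> \<Omega> u =
     Inf {ennreal c | c. 0 < c \<and> (\<integral>\<^sup>+ x. \<Phi> (ennreal (\<bar>u x\<bar> / c)) \<partial>lebesgue_on \<Omega>) \<le> 1}"

definition Lp_norm :: "real \<Rightarrow> 'a::euclidean_space set \<Rightarrow> ('a \<Rightarrow> real) \<Rightarrow> ennreal" where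
  "Lp_norm p \<Omega> u = epowr (\<integral>\<^sup>+ x. ennreal (\<bar>u x\<bar> powr p) \<partial>lebesgue_on \<Omega>) (1 / p)"

definition Lp_space :: "real \<Rightarrow> 'a::euclidean_space set \<Rightarrow> ('a \<Rightarrow> real) set" where
  "Lp_space p \<Omega> =
     {u \<in> borel_measurable (lebesgue_on \<Omega>).
       (\<integral>\<^sup>+ x. ennreal (\<bar>u x\<bar> powr p) \<partial>lebesgue_on \<Omega>) < top}"

definition energy ::
  "real \<Rightarrow> ('a::euclidean_space \<Rightarrow> real) \<Rightarrow> 'a set \<Rightarrow> ('a \<Rightarrow> real) \<Rightarrow> ennreal" where
  "energy p \<nu> \<Omega> u =
     (\<integral>\<^sup>+ x. (\<integral>\<^sup>+ y. ennreal (\<bar>u x - u y\<bar> powr p * \<nu> (x - y)) \<partial>lebesgue_on \<Omega>) \<partial>lebesgue_on \<Omega>)"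

definition W_space :: "real \<Rightarrow> ('a::euclidean_space \<Rightarrow> real) \<Rightarrow> 'a set \<Rightarrow> ('a \<Rightarrow> real) set" where
  "W_space p \<nu> \<Omega> = {u \<in> Lp_space p \<Omega>. energy p \<nu> \<Omega> u < top}"

definition W_norm ::
  "real \<Rightarrow> ('a::euclidean_space \<Rightarrow> real) \<Rightarrow> 'a set \<Rightarrow> ('a \<Rightarrow> real) \<Rightarrow> ennreal" where
  "W_norm p \<nu> \<Omega> u =
     epowr ((\<integral>\<^sup>+ x. ennreal (\<bar>u x\<bar> powr p) \<partial>lebesgue_on \<Omega>) + energy p \<nu> \<Omega> u) (1 / p)"

text \<open>
  The elements of the function spaces are classes modulo equality almost everywhere, so \<open>E\<close> acts
  on representatives and its linearity is required almost everywhere. Independence of the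
  representative follows from linearity together with the norm bound.
\<close>

definition W_extension_domain :: "real \<Rightarrow> ('a::euclidean_space \<Rightarrow> real) \<Rightarrow> 'a set \<Rightarrow> bool" where
  "W_extension_domain p \<nu> \<Omega> \<longleftrightarrow> open \<Omega> \<and>
     (\<exists>(E :: ('a \<Rightarrow> real) \<Rightarrow> 'a \<Rightarrow> real) (C :: real). C > 0 \<and>
       (\<forall>u\<in>W_space p \<nu> \<Omega>. \<forall>v\<in>W_space p \<nu> \<Omega>.
          AE x in lebesgue. E (\<lambda>z. u z + v z) x = E u x + E v x) \<and>
       (\<forall>u\<in>W_space p \<nu> \<Omega>. \<forall>c :: real.
          AE x in lebesgue. E (\<lambda>z. c * u z) x = c * E u x) \<and>
       (\<forall>u\<in>W_space p \<nu> \<Omega>.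
          E u \<in> W_space p \<nu> UNIV \<and>
          (AE x in lebesgue_on \<Omega>. E u x = u x) \<and>
          W_norm p \<nu> UNIV (E u) \<le> ennreal C * W_norm p \<nu> \<Omega> u))"

text \<open>
  The mean is a Bochner integral; it is only applied to functions in the Lebesgue and Orlicz spaces
  of the two inequalities below, which are integrable on \<open>\<Omega>\<close> when \<open>\<Omega>\<close> has finite measure.
\<close>

definition mean :: "'a::euclidean_space set \<Rightarrow> ('a \<Rightarrow> real) \<Rightarrow> real" where
  "mean \<Omega> u = (1 / measure lebesgue \<Omega>) * (\<integral> x. u x \<partial>lebesgue_on \<Omega>)"

definition poincare_sobolev :: "real \<Rightarrow> ('a::euclidean_space \<Rightarrow> real) \<Rightarrow> 'a set \<Rightarrow> bool" where
  "poincare_sobolev p \<nu> \<Omega> \<longleftrightarrow>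
     (\<exists>C::real. C > 0 \<and> (\<forall>u\<in>orlicz_space (phi p \<nu>) \<Omega>.
        luxemburg_norm (phi p \<nu>) \<Omega> (\<lambda>x. u x - mean \<Omega> u)
          \<le> ennreal C * epowr (energy p \<nu> \<Omega> u) (1 / p)))"

definition poincare :: "real \<Rightarrow> ('a::euclidean_space \<Rightarrow> real) \<Rightarrow> 'a set \<Rightarrow> bool" where
  "poincare p \<nu> \<Omega> \<longleftrightarrow>
     (\<exists>C::real. C > 0 \<and> (\<forall>u\<in>Lp_space p \<Omega>.
        Lp_norm p \<Omega> (\<lambda>x. u x - mean \<Omega> u)
          \<le> ennreal C * epowr (energy p \<nu> \<Omega> u) (1 / p)))"

end

theory Submission
  imports Defs
begin

text \<open>
  Everything rests on the Sobolev inequality on the whole space. If \<open>\<integral> \<phi>(\<bar>v\<bar> / l) \<le> 1\<close>, then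
  \<open>{\<bar>v\<bar> > s}\<close> has measure at most \<open>r = 1 / \<phi>(s / l)\<close>; the kernel has mass at least
  \<open>\<nu>\<^sup># r = (w r)\<^sup>p / r\<close> off any set of measure at most \<open>r\<close>, and \<open>w r = l / s\<close> by the definition of
  \<open>\<phi>\<close>. Taking \<open>s = \<bar>v x\<bar> / 2\<close> bounds the energy of \<open>v\<close> from below by \<open>l\<^sup>p \<integral> \<phi>(\<bar>v\<bar> / (2 l))\<close>.
  The quotient hypothesis on \<open>\<phi>\<close> is a doubling condition, so choosing \<open>l\<close> within a factor \<open>2\<close> of
  the Luxemburg norm makes the last integral bounded below. Truncation removes the assumption
  that \<open>v\<close> is bounded with support of finite measure.

  On a set of finite measure \<open>\<phi>(t) \<ge> \<phi>(1) t\<^sup>p\<close> for \<open>t \<ge> 1\<close> turns the Luxemburg norm into an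
  \<open>L\<^sup>p\<close> bound, and truncation again passes from \<open>L\<^sup>\<phi>\<close> to \<open>L\<^sup>p\<close>. Conversely one applies the
  Sobolev inequality to the extension of \<open>u\<close> minus its mean.
\<close>

section \<open>Powers on the extended half-line\<close>

lemma epowr_ennreal: "0 \<le> x \<Longrightarrow> epowr (ennreal x) a = ennreal (x powr a)"
  by (simp add: epowr_def)

lemma epowr_top [simp]: "epowr top a = top"
  by (simp add: epowr_def)

text \<open>Taking \<open>p\<close>-th powers preserves and reflects the order, also at
  \<open>top\<close>. This lets norm inequalities be proved as inequalities between integrals, where
  Fatou's lemma and sums are available.\<close>

lemma epowr_le_cmult_iff:
  assumes "0 < p" "0 < c"
  shows "epowr x (1 / p) \<le> ennreal c * epowr y (1 / p) \<longleftrightarrow> x \<le> ennreal (c powr p) * y"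
proof (cases y)
  case top
  then show ?thesis using assms by (simp add: ennreal_mult_top)
next
  case (real b)
  note b = this
  show ?thesis
  proof (cases x)
    case top
    then show ?thesis using b assms
      by (simp add: epowr_ennreal top_unique flip: ennreal_mult)
  next
    case (real a)
    have "a powr (1/p) \<le> c * b powr (1/p) \<longleftrightarrow> (a powr (1/p)) powr p \<le> (c * b powr (1/p)) powr p"
    proof
      assume "(a powr (1/p)) powr p \<le> (c * b powr (1/p)) powr p"
      then show "a powr (1/p) \<le> c * b powr (1/p)"
        using assms powr_less_mono2[of p "c * b powr (1/p)" "a powr (1/p)"] by (force simp: not_le[symmetric])
    qed (use assms in \<open>auto intro: powr_mono2\<close>)
    also have "\<dots> \<longleftrightarrow> a \<le> c powr p * b"
      using assms b real by (simp add: powr_powr powr_mult)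
    finally show ?thesis using b real assms by (simp add: epowr_ennreal flip: ennreal_mult)
  qed
qed

section \<open>Reflection invariance of Lebesgue measure\<close>

lemma lebesgue_reflection_measurable: "(\<lambda>y. x - y) \<in> lebesgue \<rightarrow>\<^sub>M lebesgue"
  for x :: "'a::euclidean_space"
proof -
  \<comment> \<open>With every coefficient equal to \<open>- 1\<close>, the sum over the basis is
    \<open>- y\<close>.\<close>
  have "(\<lambda>y. x + (\<Sum>j\<in>Basis. (- 1 * (y \<bullet> j)) *\<^sub>R j)) \<in> lebesgue \<rightarrow>\<^sub>M lebesgue"
    by (rule lebesgue_affine_measurable) simp
  then show ?thesis
    by (simp add: sum_negf euclidean_representation)
qed

text \<open>The Jacobian is a product of factors \<open>\<bar>- 1\<bar>\<close>, hence
  \<open>1\<close>. Needed for the change of variable \<open>h = x - y\<close> in the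
  energy.\<close>

lemma nn_integral_lebesgue_reflection:
  fixes f :: "'a::euclidean_space \<Rightarrow> ennreal"
  assumes "f \<in> borel_measurable lebesgue"
  shows "(\<integral>\<^sup>+ y. f (x - y) \<partial>lebesgue) = (\<integral>\<^sup>+ h. f h \<partial>lebesgue)"
proof -
  have "lebesgue = density (distr lebesgue lebesgue (\<lambda>y. x + (\<Sum>j\<in>Basis. (- 1 * (y \<bullet> j)) *\<^sub>R j)))
      (\<lambda>_. ennreal (\<Prod>j\<in>(Basis::'a set). \<bar>- 1\<bar>))"
    by (rule lebesgue_affine_euclidean) simp
  then have "lebesgue = density (distr lebesgue lebesgue (\<lambda>y. x - y)) (\<lambda>_. 1)"
    by (simp add: sum_negf euclidean_representation)
  then have "lebesgue = distr lebesgue lebesgue (\<lambda>y. x - y)"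
    by (simp add: density_1)
  then have "(\<integral>\<^sup>+ h. f h \<partial>lebesgue) = (\<integral>\<^sup>+ h. f h \<partial>distr lebesgue lebesgue (\<lambda>y. x - y))"
    by simp
  also have "\<dots> = (\<integral>\<^sup>+ y. f (x - y) \<partial>lebesgue)"
    using assms by (intro nn_integral_distr lebesgue_reflection_measurable) auto
  finally show ?thesis ..
qed

section \<open>Rearrangement and superlevel sets of the kernel\<close>

lemma unit_ball_measure_eta_power:
  assumes "0 \<le> r"
  shows "unit_ball_measure TYPE('a::euclidean_space) * eta TYPE('a) r ^ DIM('a) = r"
proof -
  have c: "0 < unit_ball_measure TYPE('a)"
    unfolding unit_ball_measure_def by (simp add: content_ball_pos)
  have "eta TYPE('a) r ^ DIM('a) = r / unit_ball_measure TYPE('a)"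
    unfolding eta_def using assms c
    by (cases "r = 0") (simp_all add: powr_powr flip: powr_realpow')
  with c show ?thesis by simp
qed

text \<open>The value of the kernel at \<open>0\<close> is arbitrary; extending by \<open>0\<close>
  gives a function that is measurable on the whole space.\<close>

lemma kernel_measurable:
  fixes \<nu> :: "'a::euclidean_space \<Rightarrow> real"
  assumes "\<nu> \<in> borel_measurable (lebesgue_on (- {0}))"
  shows "(\<lambda>h. if h = 0 then 0 else \<nu> h) \<in> borel_measurable lebesgue"
proof -
  have "(\<lambda>h. if h \<in> - {0} then \<nu> h else 0) \<in> borel_measurable lebesgue"
    using assms by (subst borel_measurable_if) auto
  also have "(\<lambda>h. if h \<in> - {0} then \<nu> h else 0) = (\<lambda>h. if h = 0 then 0 else \<nu> h)"
    by auto
  finally show ?thesis .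
qed

text \<open>Since \<open>eta\<close> is the radius of the ball of volume \<open>r\<close>, a level
  \<open>s\<close> violating the claim would be admissible in the infimum defining the
  rearrangement.\<close>

lemma emeasure_superlevel_gt_below_rearrangement:
  fixes \<nu> :: "'a::euclidean_space \<Rightarrow> real"
  assumes "0 \<le> r" "0 < s" "ennreal s < rearrangement \<nu> (eta TYPE('a) r)"
  shows "ennreal r < emeasure lebesgue {h. h \<noteq> 0 \<and> \<nu> h > s}"
proof (rule ccontr)
  assume "\<not> ?thesis"
  then have "rearrangement \<nu> (eta TYPE('a) r) \<le> ennreal s"
    unfolding rearrangement_def using assms by (intro Inf_lower) (auto simp: unit_ball_measure_eta_power)
  with assms show False by simp
qed

text \<open>Bathtub principle: among the sets of measure at most \<open>r\<close>, removing a superlevel set of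
  \<open>\<nu>\<close> leaves the smallest mass.\<close>

lemma nu_sharp_le_nn_integral_Compl:
  fixes \<nu> :: "'a::euclidean_space \<Rightarrow> real"
  assumes meas: "\<nu> \<in> borel_measurable (lebesgue_on (- {0}))"
    and nonneg: "\<And>h. h \<noteq> 0 \<Longrightarrow> 0 \<le> \<nu> h"
    and F: "F \<in> sets lebesgue" "emeasure lebesgue F \<le> ennreal r" and r: "0 < r"
    and fin: "nu_sharp \<nu> r < top"
  shows "nu_sharp \<nu> r \<le> (\<integral>\<^sup>+ h\<in>- F. ennreal (if h = 0 then 0 else \<nu> h) \<partial>lebesgue)"
proof -
  define k where "k h = (if h = 0 then 0 else \<nu> h)" for h
  have k [measurable]: "k \<in> borel_measurable lebesgue"
    unfolding k_def[abs_def] by (rule kernel_measurable[OF meas])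
  have k0: "0 \<le> k h" for h using nonneg by (simp add: k_def)
  note [measurable] = F(1)
  define \<tau> where "\<tau> = rearrangement \<nu> (eta TYPE('a) r)"
  have ns: "nu_sharp \<nu> r = (\<integral>\<^sup>+ h. ennreal (k h) * indicator {h. ennreal (k h) < \<tau>} h \<partial>lebesgue)"
    unfolding nu_sharp_def \<tau>_def[symmetric] k_def by (intro nn_integral_cong) (auto simp: indicator_def)
  have slev: "{h. h \<noteq> 0 \<and> \<nu> h > s} = {h. k h > s}" if "0 < s" for s
    using that by (auto simp: k_def)
  have gt: "ennreal r < emeasure lebesgue {h. k h > s}" if "0 < s" "ennreal s < \<tau>" for s
    using emeasure_superlevel_gt_below_rearrangement[of r s \<nu>] that r slev[of s] by (simp add: \<tau>_def)
  have slev_meas: "{h. k h > s} \<in> sets lebesgue" for s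
    using measurable_sets[OF k, of "{s<..}"] by (simp add: vimage_def)
  have mid_meas: "{h. k h > s \<and> ennreal (k h) < \<tau>} \<in> sets lebesgue" for s
  proof -
    have "Measurable.pred lebesgue (\<lambda>h. k h > s \<and> ennreal (k h) < \<tau>)" by measurable
    then show ?thesis by (simp add: pred_def)
  qed
  \<comment> \<open>Markov's inequality on the region over which \<open>nu_sharp\<close>
    integrates.\<close>
  have mark: "ennreal s * emeasure lebesgue {h. k h > s \<and> ennreal (k h) < \<tau>} \<le> nu_sharp \<nu> r" for s
  proof -
    have "ennreal s * emeasure lebesgue {h. k h > s \<and> ennreal (k h) < \<tau>}
      = (\<integral>\<^sup>+ h. ennreal s * indicator {h. k h > s \<and> ennreal (k h) < \<tau>} h \<partial>lebesgue)"
      by (rule nn_integral_cmult_indicator[OF mid_meas, symmetric])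
    also have "\<dots> \<le> nu_sharp \<nu> r" unfolding ns
      by (intro nn_integral_mono) (auto simp: indicator_def intro!: ennreal_leI)
    finally show ?thesis .
  qed
  consider "\<tau> = 0" | "\<tau> = top" | t where "0 < t" "\<tau> = ennreal t"
    by (cases \<tau>) (force simp: less_le)+
  then show ?thesis
  proof cases
    case 1
    then show ?thesis by (simp add: ns)
  next
    case 2
    obtain I where I: "0 \<le> I" "nu_sharp \<nu> r = ennreal I"
      using fin by (cases "nu_sharp \<nu> r") auto
    \<comment> \<open>At this level \<open>mark\<close> would give \<open>I + 1 \<le> I\<close>, so
      a finite \<open>nu_sharp\<close> excludes an infinite threshold.\<close>
    define s where "s = (I + 1) / r"
    have s: "0 < s" using I r by (simp add: s_def)
    have "ennreal (I + 1) = ennreal s * ennreal r"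
      using s r by (simp add: s_def flip: ennreal_mult)
    also have "\<dots> \<le> ennreal s * emeasure lebesgue {h. k h > s}"
      using gt[of s] s 2 by (intro mult_left_mono) auto
    also have "\<dots> \<le> ennreal I" using mark[of s] 2 I by simp
    finally show ?thesis using I by simp
  next
    case 3
    note t = this
    define A B where "A = {h. k h < t}" and "B = {h. t \<le> k h}"
    have A [measurable]: "A \<in> sets lebesgue"
      using measurable_sets[OF k, of "{..<t}"] by (simp add: vimage_def A_def)
    have B [measurable]: "B \<in> sets lebesgue"
      using measurable_sets[OF k, of "{t..}"] by (simp add: vimage_def B_def)
    have "{h. ennreal (k h) < \<tau>} = A"
      using t k0 by (auto simp: A_def ennreal_less_iff)
    with ns have nsA: "nu_sharp \<nu> r = (\<integral>\<^sup>+ h. ennreal (k h) * indicator A h \<partial>lebesgue)"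
      by simp
    \<comment> \<open>The strict bound \<open>gt\<close> is known only below the threshold.
      \<open>B\<close> is the decreasing intersection of strict superlevel sets at levels increasing
      to \<open>t\<close>; continuity from above needs their measures finite, which
      \<open>mark\<close> supplies once \<open>B\<close> itself has finite measure.\<close>
    have Br: "ennreal r \<le> emeasure lebesgue B"
    proof (cases "emeasure lebesgue B = top")
      case False
      \<comment> \<open>The shift by \<open>2\<close> keeps \<open>s 0\<close> positive, as
        \<open>gt\<close> and \<open>mark\<close> need positive levels.\<close>
      define s where "s n = t * (1 - 1 / (real n + 2))" for n
      have s: "0 < s n" "s n < t" for n
        using t by (auto simp: s_def field_simps intro!: add_pos_nonneg mult_nonneg_nonneg)
      have lim: "s \<longlonglongrightarrow> t"
      proof -
        have "(\<lambda>n. t * (1 - inverse (real (Suc (Suc n))))) \<longlonglongrightarrow> t * (1 - 0)"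
          by (intro tendsto_intros LIMSEQ_Suc[OF LIMSEQ_inverse_real_of_nat])
        then show ?thesis by (simp add: s_def[abs_def] inverse_eq_divide add.commute)
      qed
      have inc: "s m \<le> s n" if "m \<le> n" for m n
        unfolding s_def using t that
        by (intro mult_left_mono diff_left_mono divide_left_mono) auto
      have BI: "B = (\<Inter>n. {h. k h > s n})"
      proof (intro equalityI subsetI)
        fix h assume "h \<in> B"
        then show "h \<in> (\<Inter>n. {h. k h > s n})" using s(2) by (auto simp: B_def intro: less_le_trans)
      next
        fix h assume "h \<in> (\<Inter>n. {h. k h > s n})"
        then have "t \<le> k h" by (intro LIMSEQ_le_const2[OF lim]) (auto intro: less_imp_le)
        then show "h \<in> B" by (simp add: B_def)
      qed
      have fin': "emeasure lebesgue {h. k h > s n} \<noteq> \<infinity>" for n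
      proof -
        have "{h. k h > s n} \<subseteq> B \<union> {h. k h > s n \<and> ennreal (k h) < \<tau>}"
          using t k0 by (auto simp: B_def ennreal_less_iff)
        moreover have "emeasure lebesgue {h. k h > s n \<and> ennreal (k h) < \<tau>} \<noteq> top"
          using mark[of "s n"] fin s(1)[of n] by (auto simp: ennreal_mult_top)
        ultimately have "emeasure lebesgue {h. k h > s n} \<le> emeasure lebesgue B +
            emeasure lebesgue {h. k h > s n \<and> ennreal (k h) < \<tau>}"
          using B mid_meas by (intro order.trans[OF emeasure_mono emeasure_subadditive]) auto
        also have "\<dots> < top"
          using False \<open>emeasure lebesgue {h. k h > s n \<and> ennreal (k h) < \<tau>} \<noteq> top\<close> by (simp add: less_top)
        finally show ?thesis by simp
      qed
      have "(\<lambda>n. emeasure lebesgue {h. k h > s n}) \<longlonglongrightarrow> emeasure lebesgue (\<Inter>n. {h. k h > s n})"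
      proof (rule Lim_emeasure_decseq)
        show "decseq (\<lambda>n. {h. k h > s n})"
          using inc by (force simp: decseq_def intro: le_less_trans)
      qed (use slev_meas fin' in auto)
      then show ?thesis unfolding BI
        using gt s t by (intro LIMSEQ_le_const) (auto simp: ennreal_less_iff intro!: less_imp_le)
    qed simp
    \<comment> \<open>Splitting both \<open>F\<close> and \<open>B\<close> along
      \<open>B \<inter> F\<close> shows that the part of \<open>F\<close> inside \<open>A\<close> is
      no larger than the part of \<open>B\<close> outside \<open>F\<close>.\<close>
    have "emeasure lebesgue (A \<inter> F) + emeasure lebesgue (B \<inter> F) = emeasure lebesgue F"
    proof (subst plus_emeasure)
      have "A \<inter> F \<union> B \<inter> F = F" by (auto simp: A_def B_def)
      then show "emeasure lebesgue (A \<inter> F \<union> B \<inter> F) = emeasure lebesgue F" by simp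
    qed (auto simp: A_def B_def A[unfolded A_def] B[unfolded B_def])
    also have "\<dots> \<le> emeasure lebesgue B" using F(2) Br by simp
    also have "\<dots> = emeasure lebesgue (B - F) + emeasure lebesgue (B \<inter> F)"
    proof (subst plus_emeasure)
      have "B - F \<union> B \<inter> F = B" by auto
      then show "emeasure lebesgue B = emeasure lebesgue (B - F \<union> B \<inter> F)" by simp
    qed auto
    finally have AF: "emeasure lebesgue (A \<inter> F) \<le> emeasure lebesgue (B - F)"
    proof -
      \<comment> \<open>The common term may be cancelled because \<open>F\<close> has finite
        measure.\<close>
      have "emeasure lebesgue (B \<inter> F) \<le> emeasure lebesgue F" by (intro emeasure_mono) auto
      also have "\<dots> < top" using F(2) by (simp add: le_less_trans)
      finally show "emeasure lebesgue (A \<inter> F) + emeasure lebesgue (B \<inter> F)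
          \<le> emeasure lebesgue (B - F) + emeasure lebesgue (B \<inter> F) \<Longrightarrow> ?thesis"
        by (metis add.commute ennreal_add_left_cancel_le less_irrefl infinity_ennreal_def)
    qed
    \<comment> \<open>Exchange argument: the kernel is below \<open>t\<close> on
      \<open>A \<inter> F\<close> and at least \<open>t\<close> on \<open>B - F\<close>, so trading
      the first set for the second does not lose mass.\<close>
    have "nu_sharp \<nu> r = (\<integral>\<^sup>+ h. ennreal (k h) * indicator (A - F) h
        + ennreal (k h) * indicator (A \<inter> F) h \<partial>lebesgue)"
      unfolding nsA by (intro nn_integral_cong) (auto simp: indicator_def)
    also have "\<dots> = (\<integral>\<^sup>+ h. ennreal (k h) * indicator (A - F) h \<partial>lebesgue)
        + (\<integral>\<^sup>+ h. ennreal (k h) * indicator (A \<inter> F) h \<partial>lebesgue)"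
      by (rule nn_integral_add) auto
    also have "(\<integral>\<^sup>+ h. ennreal (k h) * indicator (A \<inter> F) h \<partial>lebesgue)
        \<le> (\<integral>\<^sup>+ h. ennreal t * indicator (A \<inter> F) h \<partial>lebesgue)"
      by (intro nn_integral_mono) (auto simp: indicator_def A_def intro!: ennreal_leI)
    also have "\<dots> = ennreal t * emeasure lebesgue (A \<inter> F)"
      by (rule nn_integral_cmult_indicator) auto
    also have "\<dots> \<le> ennreal t * emeasure lebesgue (B - F)"
      using AF by (rule mult_left_mono) simp
    also have "\<dots> = (\<integral>\<^sup>+ h. ennreal t * indicator (B - F) h \<partial>lebesgue)"
      by (rule nn_integral_cmult_indicator[symmetric]) auto
    also have "\<dots> \<le> (\<integral>\<^sup>+ h. ennreal (k h) * indicator (B - F) h \<partial>lebesgue)"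
      by (intro nn_integral_mono) (auto simp: indicator_def B_def intro!: ennreal_leI)
    also have "(\<integral>\<^sup>+ h. ennreal (k h) * indicator (A - F) h \<partial>lebesgue)
        + (\<integral>\<^sup>+ h. ennreal (k h) * indicator (B - F) h \<partial>lebesgue)
      = (\<integral>\<^sup>+ h. ennreal (k h) * indicator (A - F) h + ennreal (k h) * indicator (B - F) h \<partial>lebesgue)"
      by (rule nn_integral_add[symmetric]) auto
    also have "\<dots> = (\<integral>\<^sup>+ h\<in>- F. ennreal (k h) \<partial>lebesgue)"
      by (intro nn_integral_cong) (auto simp: indicator_def A_def B_def)
    finally show ?thesis by (simp add: k_def add_left_mono)
  qed
qed

section \<open>Energy and truncation\<close>

lemma energy_mono_Lipschitz:
  assumes "1 \<le> p" and nonneg: "\<And>h. h \<noteq> 0 \<Longrightarrow> 0 \<le> \<nu> h"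
    and lip: "\<And>x y. \<bar>f x - f y\<bar> \<le> \<bar>u x - u y\<bar>"
  shows "energy p \<nu> \<Omega> f \<le> energy p \<nu> \<Omega> u"
  unfolding energy_def
proof (intro nn_integral_mono ennreal_leI)
  fix x y
  show "\<bar>f x - f y\<bar> powr p * \<nu> (x - y) \<le> \<bar>u x - u y\<bar> powr p * \<nu> (x - y)"
  \<comment> \<open>On the diagonal the sign of the kernel is unknown, but both differences vanish
    there.\<close>
  proof (cases "x = y")
    case False
    then show ?thesis using assms by (intro mult_right_mono powr_mono2) auto
  qed simp
qed

definition truncate :: "real \<Rightarrow> real \<Rightarrow> real" where
  "truncate n t = max (- n) (min n t)"

lemma truncate_Lipschitz: "\<bar>truncate n s - truncate n t\<bar> \<le> \<bar>s - t\<bar>"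
  by (auto simp: truncate_def max_def min_def)

text \<open>The map \<open>t - truncate n t\<close> is soft thresholding: it sends
  \<open>[-n, n]\<close> to \<open>0\<close> and shifts the rest towards \<open>0\<close>. It serves
  to make supports small without increasing the energy.\<close>

lemma diff_truncate_Lipschitz: "0 \<le> n \<Longrightarrow> \<bar>(s - truncate n s) - (t - truncate n t)\<bar> \<le> \<bar>s - t\<bar>"
  by (auto simp: truncate_def max_def min_def)

lemma abs_truncate_le: "0 \<le> n \<Longrightarrow> \<bar>truncate n t\<bar> \<le> n"
  by (auto simp: truncate_def)

lemma abs_truncate_le_abs: "0 \<le> n \<Longrightarrow> \<bar>truncate n t\<bar> \<le> \<bar>t\<bar>"
  by (auto simp: truncate_def)

lemma truncate_eq_self: "\<bar>t\<bar> \<le> n \<Longrightarrow> truncate n t = t"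
  by (auto simp: truncate_def)

lemma truncate_measurable [measurable]: "truncate n \<in> borel_measurable borel"
  unfolding truncate_def[abs_def] by measurable

lemma tendsto_truncate: "(\<lambda>n. truncate (real n) t) \<longlonglongrightarrow> t"
proof (rule tendsto_eventually)
  show "\<forall>\<^sub>F n in sequentially. truncate (real n) t = t"
    using eventually_ge_at_top[of "nat \<lceil>\<bar>t\<bar>\<rceil>"]
    by eventually_elim (intro truncate_eq_self, linarith)
qed

section \<open>Growth and doubling of the Young function\<close>

locale sobolev_kernel =
  fixes \<nu> :: "'a::euclidean_space \<Rightarrow> real" and p :: real
  assumes p_ge_1: "1 \<le> p"
    and kernel_meas: "\<nu> \<in> borel_measurable (lebesgue_on (- {0}))"
    and kernel_nonneg: "\<And>h. h \<noteq> 0 \<Longrightarrow> 0 \<le> \<nu> h"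
    and potential_inv: "potential_invertible p \<nu>"
    and young: "young_function (\<lambda>t. phi p \<nu> (epowr t (1 / p)))"
    and phi_quotient: "\<exists>\<theta>::real. \<theta> > 0 \<and> (\<forall>s t::real. 0 \<le> s \<and> s \<le> t \<and> 0 < t \<longrightarrow>
           phi p \<nu> (ennreal (\<theta> * s / t)) \<le> phi p \<nu> (ennreal s) / phi p \<nu> (ennreal t))"
begin

text \<open>On real arguments \<open>phi\<close> is finite, as \<open>phi_eq_rphi\<close> confirms,
  so real arithmetic loses nothing. Negative arguments are sent to \<open>0\<close>.\<close>

definition rphi :: "real \<Rightarrow> real" where
  "rphi t = enn2real (phi p \<nu> (ennreal t))"

text \<open>The potential maps onto \<open>{..<top}\<close>, so \<open>1 / t\<close> is attained at
  some \<open>r\<close>; this \<open>r\<close> is not \<open>0\<close> because the potential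
  vanishes there, so \<open>1 / r\<close> is a genuine reciprocal.\<close>

lemma phi_eq_inverse_potential:
  assumes "0 < t"
  obtains r where "0 < r" "phi p \<nu> (ennreal t) = ennreal (1 / r)" "potential p \<nu> r = ennreal (1 / t)"
proof -
  define r where "r = the_inv_into {0..} (potential p \<nu>) (ennreal (1 / t))"
  have bij: "bij_betw (potential p \<nu>) {0..} {..<top}"
    using potential_inv by (simp add: potential_invertible_def)
  have w: "potential p \<nu> r = ennreal (1 / t)"
    unfolding r_def by (rule f_the_inv_into_f_bij_betw[OF bij]) simp
  have "r \<in> {0..}"
    using the_inv_into_into[OF bij_betw_imp_inj_on[OF bij], of "ennreal (1 / t)" "{0..}"]
      bij_betw_imp_surj_on[OF bij] by (auto simp: r_def)
  moreover have "r \<noteq> 0" using w assms by (auto simp: potential_def)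
  ultimately have r: "0 < r" by simp
  have inv: "1 / ennreal s = ennreal (1 / s)" if "0 < s" for s
    using that divide_ennreal[of 1 s] by simp
  have "phi p \<nu> (ennreal t) = ennreal (1 / r)"
    using assms r by (simp add: phi_def potential_inv_def inv flip: r_def)
  with r w show thesis by (intro that)
qed

lemma phi_eq_rphi: "phi p \<nu> (ennreal t) = ennreal (rphi t)"
proof (cases "0 < t")
  case True
  then obtain r where "0 < r" "phi p \<nu> (ennreal t) = ennreal (1 / r)"
    by (rule phi_eq_inverse_potential)
  then show ?thesis by (simp add: rphi_def)
next
  case False
  then show ?thesis by (simp add: rphi_def phi_def ennreal_neg)
qed

lemma rphi_nonpos [simp]: "t \<le> 0 \<Longrightarrow> rphi t = 0"
  by (simp add: rphi_def phi_def ennreal_neg)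

lemma rphi_nonneg [simp]: "0 \<le> rphi t"
  by (simp add: rphi_def)

lemma rphi_pos: "0 < t \<Longrightarrow> 0 < rphi t"
  by (erule phi_eq_inverse_potential) (simp add: rphi_def)

text \<open>Convexity of \<open>\<lambda>t. phi p \<nu> (epowr t (1 / p))\<close> on the segment
  from \<open>0\<close> to \<open>t powr p\<close>, evaluated at \<open>s powr p\<close>; the
  endpoint \<open>0\<close> contributes nothing.\<close>

lemma rphi_scale:
  assumes "0 \<le> s" "s \<le> t" "0 < t"
  shows "rphi s \<le> (s / t) powr p * rphi t"
proof -
  define a where "a = (s / t) powr p"
  have a: "0 \<le> a" "a \<le> 1"
    unfolding a_def using assms p_ge_1 by (auto intro!: powr_le1)
  have "phi p \<nu> (epowr (ennreal (1 - a) * 0 + ennreal a * ennreal (t powr p)) (1 / p))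
    \<le> ennreal (1 - a) * phi p \<nu> (epowr 0 (1 / p)) + ennreal a * phi p \<nu> (epowr (ennreal (t powr p)) (1 / p))"
    using young a unfolding young_function_def by fastforce
  moreover have "ennreal a * ennreal (t powr p) = ennreal (s powr p)"
    using assms a by (simp add: a_def powr_divide flip: ennreal_mult)
  moreover have "epowr 0 (1 / p) = 0" by (simp add: epowr_def)
  moreover have "phi p \<nu> 0 = 0" by (simp add: phi_def)
  ultimately have "phi p \<nu> (ennreal s) \<le> ennreal a * phi p \<nu> (ennreal t)"
    using assms p_ge_1 by (simp add: epowr_ennreal powr_powr)
  then have "ennreal (rphi s) \<le> ennreal (a * rphi t)"
    using a by (simp add: phi_eq_rphi ennreal_mult)
  then show ?thesis using a by (simp add: a_def)
qed

lemma mono_rphi: "mono rphi"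
proof (rule monoI)
  fix s t :: real
  assume st: "s \<le> t"
  show "rphi s \<le> rphi t"
  proof (cases "0 < s")
    case True
    have "rphi s \<le> (s / t) powr p * rphi t" using True st by (intro rphi_scale) auto
    also have "\<dots> \<le> 1 * rphi t"
      using True st p_ge_1 by (intro mult_right_mono powr_le1) auto
    finally show ?thesis by simp
  qed simp
qed

lemma rphi_measurable [measurable]: "rphi \<in> borel_measurable borel"
  by (rule borel_measurable_mono[OF mono_rphi])

text \<open>The quotient hypothesis at the ratio \<open>1 / 4\<close>, with
  \<open>\<kappa> = rphi (\<theta> / 4)\<close>. The factor \<open>4\<close> is two halvings: one
  from the level set at half height in \<open>modular_le_energy\<close>, one from a dyadic step in
  \<open>modular_le_1_bounded\<close>.\<close>

lemma rphi_doubling: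
  obtains \<kappa> where "0 < \<kappa>" "\<And>t. 0 \<le> t \<Longrightarrow> \<kappa> * rphi (4 * t) \<le> rphi t"
proof -
  obtain \<theta> :: real where \<theta>: "\<theta> > 0" and q: "\<And>s t::real. 0 \<le> s \<Longrightarrow> s \<le> t \<Longrightarrow> 0 < t \<Longrightarrow>
      phi p \<nu> (ennreal (\<theta> * s / t)) \<le> phi p \<nu> (ennreal s) / phi p \<nu> (ennreal t)"
    using phi_quotient by blast
  have "rphi (\<theta> / 4) * rphi (4 * t) \<le> rphi t" if "0 \<le> t" for t
  proof (cases "t = 0")
    case False
    with that have t: "0 < t" by simp
    have "phi p \<nu> (ennreal (\<theta> * t / (4 * t))) \<le> phi p \<nu> (ennreal t) / phi p \<nu> (ennreal (4 * t))"
      using t by (intro q) auto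
    moreover have "\<theta> * t / (4 * t) = \<theta> / 4" using t by simp
    ultimately have "ennreal (rphi (\<theta> / 4)) \<le> ennreal (rphi t / rphi (4 * t))"
      using t rphi_pos[of "4 * t"] by (simp add: phi_eq_rphi divide_ennreal)
    then have "rphi (\<theta> / 4) \<le> rphi t / rphi (4 * t)" by simp
    then show ?thesis using t rphi_pos[of "4 * t"] by (simp add: pos_le_divide_eq)
  qed simp
  moreover have "0 < rphi (\<theta> / 4)" using \<theta> by (intro rphi_pos) simp
  ultimately show ?thesis using that by blast
qed

section \<open>Sobolev inequality on the whole space\<close>

text \<open>For \<open>r = 1 / rphi t\<close> the potential equals \<open>1 / t\<close>, that is,
  \<open>r\<close> times \<open>nu_sharp\<close> at \<open>r\<close> is
  \<open>(1 / t) powr p\<close>. The left-hand side is therefore \<open>nu_sharp \<nu> r\<close>,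
  and the bathtub principle applies.\<close>

lemma kernel_tail_ge:
  assumes F: "F \<in> sets lebesgue" "emeasure lebesgue F \<le> ennreal (1 / rphi t)" and t: "0 < t"
  shows "ennreal ((1 / t) powr p * rphi t)
    \<le> (\<integral>\<^sup>+ h\<in>- F. ennreal (if h = 0 then 0 else \<nu> h) \<partial>lebesgue)"
proof -
  from t obtain r where r: "0 < r" "phi p \<nu> (ennreal t) = ennreal (1 / r)"
      "potential p \<nu> r = ennreal (1 / t)"
    by (rule phi_eq_inverse_potential)
  then have rphi: "rphi t = 1 / r" by (simp add: rphi_def)
  have w: "epowr (ennreal r * nu_sharp \<nu> r) (1 / p) = ennreal (1 / t)"
    using r by (simp add: potential_def)
  \<comment> \<open>An infinite value would make the potential at \<open>r\<close> infinite.\<close>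
  then have "nu_sharp \<nu> r \<noteq> top"
    using r(1) by (auto simp: ennreal_mult_top)
  then have fin: "nu_sharp \<nu> r < top" by (simp add: less_top)
  then obtain S where S: "0 \<le> S" "nu_sharp \<nu> r = ennreal S"
    by (cases "nu_sharp \<nu> r") auto
  have "(r * S) powr (1 / p) = 1 / t"
    using w S r t by (simp add: epowr_ennreal flip: ennreal_mult)
  then have "((r * S) powr (1 / p)) powr p = (1 / t) powr p" by simp
  then have "r * S = (1 / t) powr p" using S r p_ge_1 by (simp add: powr_powr)
  then have "(1 / t) powr p * rphi t = S" using r by (simp add: rphi field_simps)
  then have "ennreal ((1 / t) powr p * rphi t) = nu_sharp \<nu> r" by (simp add: S)
  also have "\<dots> \<le> (\<integral>\<^sup>+ h\<in>- F. ennreal (if h = 0 then 0 else \<nu> h) \<partial>lebesgue)"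
    using F r fin by (intro nu_sharp_le_nn_integral_Compl kernel_meas kernel_nonneg) (auto simp: rphi)
  finally show ?thesis .
qed

text \<open>The points \<open>y\<close> with \<open>\<bar>v y\<bar> \<le> \<bar>v x\<bar> / 2\<close> contribute to the inner integral at \<open>x\<close>; their
  complement has measure at most \<open>1 / \<phi>(\<bar>v x\<bar> / (2 * l))\<close> by Chebyshev's inequality.\<close>

lemma modular_le_energy:
  assumes v: "v \<in> borel_measurable lebesgue" and l: "0 < l"
    and mod: "(\<integral>\<^sup>+ x. ennreal (rphi (\<bar>v x\<bar> / l)) \<partial>lebesgue) \<le> 1"
  shows "ennreal (l powr p) * (\<integral>\<^sup>+ x. ennreal (rphi (\<bar>v x\<bar> / (2 * l))) \<partial>lebesgue) \<le> energy p \<nu> UNIV v"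
proof -
  note [measurable] = v
  define k where "k h = (if h = 0 then 0 else \<nu> h)" for h
  have k [measurable]: "k \<in> borel_measurable lebesgue"
    unfolding k_def[abs_def] by (rule kernel_measurable[OF kernel_meas])
  have "ennreal (l powr p * rphi (\<bar>v x\<bar> / (2 * l)))
      \<le> (\<integral>\<^sup>+ y. ennreal (\<bar>v x - v y\<bar> powr p * \<nu> (x - y)) \<partial>lebesgue)" for x
  proof (cases "v x = 0")
    case False
    define s where "s = \<bar>v x\<bar> / 2"
    have s: "0 < s" using False by (simp add: s_def)
    define c where "c = rphi (s / l)"
    have c: "0 < c" unfolding c_def using s l by (intro rphi_pos) simp
    define E where "E = {y. s < \<bar>v y\<bar>}"
    \<comment> \<open>The exceptional set in the variable \<open>h = x - y\<close>; reflection
      preserves its measure.\<close>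
    define F where "F = {h. x - h \<in> E}"
    have E [measurable]: "E \<in> sets lebesgue"
    proof -
      have "Measurable.pred lebesgue (\<lambda>y. s < \<bar>v y\<bar>)" by measurable
      then show ?thesis by (simp add: pred_def E_def)
    qed
    have F_vimage: "F = (\<lambda>h. x - h) -` E \<inter> space lebesgue" by (auto simp: F_def)
    have F [measurable]: "F \<in> sets lebesgue"
      unfolding F_vimage by (rule measurable_sets[OF lebesgue_reflection_measurable E])
    have "emeasure lebesgue F = (\<integral>\<^sup>+ h. indicator F h \<partial>lebesgue)"
      by simp
    also have "\<dots> = (\<integral>\<^sup>+ h. indicator E (x - h) \<partial>lebesgue)"
      by (intro nn_integral_cong) (simp add: F_def indicator_def)
    also have "\<dots> = emeasure lebesgue E"
      by (subst nn_integral_lebesgue_reflection) auto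
    finally have FE: "emeasure lebesgue F = emeasure lebesgue E" .
    have "ennreal c * emeasure lebesgue E = (\<integral>\<^sup>+ y. ennreal c * indicator E y \<partial>lebesgue)"
      by (subst nn_integral_cmult_indicator) auto
    also have "\<dots> \<le> (\<integral>\<^sup>+ x. ennreal (rphi (\<bar>v x\<bar> / l)) \<partial>lebesgue)"
      unfolding c_def E_def using l
      by (intro nn_integral_mono)
         (auto simp: indicator_def intro!: ennreal_leI monoD[OF mono_rphi] divide_right_mono)
    also have "\<dots> \<le> 1" by (rule mod)
    finally have "ennreal (1 / c) * (ennreal c * emeasure lebesgue E) \<le> ennreal (1 / c) * 1"
      by (rule mult_left_mono) simp
    moreover have "ennreal (1 / c) * (ennreal c * emeasure lebesgue E) = emeasure lebesgue E"
      using c by (simp add: mult.assoc[symmetric] flip: ennreal_mult)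
    ultimately have Fc: "emeasure lebesgue F \<le> ennreal (1 / c)" by (simp add: FE)
    \<comment> \<open>The lower bound \<open>s powr p\<close> for the difference cancels the factor
      \<open>(l / s) powr p\<close> of the kernel tail, so the constant no longer depends on
      \<open>x\<close>.\<close>
    have "ennreal (l powr p * rphi (\<bar>v x\<bar> / (2 * l))) = ennreal (s powr p * ((1 / (s / l)) powr p * c))"
    proof -
      have "s powr p * (1 / (s / l)) powr p = l powr p"
        using s l by (simp add: powr_divide)
      moreover have "\<bar>v x\<bar> / (2 * l) = s / l" by (simp add: s_def)
      ultimately show ?thesis by (simp add: c_def mult.assoc[symmetric])
    qed
    also have "\<dots> = ennreal (s powr p) * ennreal ((1 / (s / l)) powr p * c)"
      using c by (intro ennreal_mult) auto
    also have "\<dots> \<le> ennreal (s powr p) * (\<integral>\<^sup>+ h\<in>- F. ennreal (k h) \<partial>lebesgue)"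
      unfolding c_def k_def using s l Fc
      by (intro mult_left_mono kernel_tail_ge) (auto simp: c_def)
    also have "(\<integral>\<^sup>+ h\<in>- F. ennreal (k h) \<partial>lebesgue) = (\<integral>\<^sup>+ y. ennreal (k (x - y)) * indicator (- F) (x - y) \<partial>lebesgue)"
      by (rule nn_integral_lebesgue_reflection[symmetric]) simp
    also have "ennreal (s powr p) * \<dots> = (\<integral>\<^sup>+ y. ennreal (s powr p) * (ennreal (k (x - y)) * indicator (- F) (x - y)) \<partial>lebesgue)"
      using measurable_compose[OF lebesgue_reflection_measurable, of "\<lambda>h. ennreal (k h) * indicator (- F) h" borel x]
      by (intro nn_integral_cmult[symmetric]) simp
    also have "\<dots> \<le> (\<integral>\<^sup>+ y. ennreal (\<bar>v x - v y\<bar> powr p * \<nu> (x - y)) \<partial>lebesgue)"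
    proof (rule nn_integral_mono)
      fix y
      show "ennreal (s powr p) * (ennreal (k (x - y)) * indicator (- F) (x - y))
        \<le> ennreal (\<bar>v x - v y\<bar> powr p * \<nu> (x - y))"
      proof (cases "x = y \<or> y \<in> E")
        case True
        then show ?thesis by (auto simp: k_def F_def)
      next
        case False
        then have "\<bar>v y\<bar> \<le> s" by (simp add: E_def)
          then have "s \<le> \<bar>v x - v y\<bar>" unfolding s_def by linarith
        then have "s powr p \<le> \<bar>v x - v y\<bar> powr p"
          using s p_ge_1 by (intro powr_mono2) auto
        with False kernel_nonneg[of "x - y"] show ?thesis
          by (auto simp: k_def indicator_def mult_right_mono intro!: ennreal_leI simp flip: ennreal_mult)
      qed
    qed
    finally show ?thesis .
  qed simp
  then have "(\<integral>\<^sup>+ x. ennreal (l powr p * rphi (\<bar>v x\<bar> / (2 * l))) \<partial>lebesgue) \<le> energy p \<nu> UNIV v"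
    unfolding energy_def lebesgue_on_UNIV_eq by (intro nn_integral_mono)
  then show ?thesis by (simp add: ennreal_mult nn_integral_cmult)
qed

text \<open>If the modular exceeds \<open>1\<close> at scale \<open>l\<close>, some dyadic scale
  \<open>\<mu> \<ge> l\<close> has modular at most \<open>1\<close> while \<open>\<mu> / 2\<close>
  does not. There \<open>modular_le_energy\<close> applies, and doubling bounds its integral below
  by \<open>\<kappa>\<close>, so the energy is at least \<open>\<mu> powr p * \<kappa>\<close>,
  against \<open>small\<close>.\<close>

lemma modular_le_1_bounded:
  assumes v: "v \<in> borel_measurable lebesgue" and l: "0 < l"
    and bdd: "\<And>x. \<bar>v x\<bar> \<le> B" and supp: "emeasure lebesgue {x. v x \<noteq> 0} < top"
    and \<kappa>: "0 < \<kappa>" "\<And>t. 0 \<le> t \<Longrightarrow> \<kappa> * rphi (4 * t) \<le> rphi t"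
    and small: "energy p \<nu> UNIV v < ennreal (l powr p * \<kappa>)"
  shows "(\<integral>\<^sup>+ x. ennreal (rphi (\<bar>v x\<bar> / l)) \<partial>lebesgue) \<le> 1"
proof (rule ccontr)
  note [measurable] = v
  define P where "P k \<longleftrightarrow> (\<integral>\<^sup>+ x. ennreal (rphi (\<bar>v x\<bar> / (2 ^ k * l))) \<partial>lebesgue) \<le> 1" for k :: nat
  assume "\<not> ?thesis"
  then have nP0: "\<not> P 0" by (simp add: P_def)
  have S: "{x. v x \<noteq> 0} \<in> sets lebesgue"
  proof -
    have "Measurable.pred lebesgue (\<lambda>x. v x \<noteq> 0)" by measurable
    then show ?thesis by (simp add: pred_def)
  qed
  obtain m where m: "0 \<le> m" "emeasure lebesgue {x. v x \<noteq> 0} = ennreal m"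
    using supp by (cases "emeasure lebesgue {x. v x \<noteq> 0}") auto
  \<comment> \<open>Boundedness and a support of finite measure enter here:
    \<open>rphi_scale\<close> with \<open>p \<ge> 1\<close> gains at least \<open>2 ^ N\<close>, so
    the dyadic search stops.\<close>
  obtain N :: nat where N: "rphi (B / l) * m < 2 ^ N"
    using real_arch_pow[of 2] by auto
  have "P N"
  proof -
    have pt: "rphi (\<bar>v x\<bar> / (2 ^ N * l)) \<le> rphi (B / l) / 2 ^ N" for x
    proof (cases "v x = 0")
      case False
      have "rphi (\<bar>v x\<bar> / (2 ^ N * l))
          \<le> (\<bar>v x\<bar> / (2 ^ N * l) / (\<bar>v x\<bar> / l)) powr p * rphi (\<bar>v x\<bar> / l)"
        using False l by (intro rphi_scale divide_left_mono) auto
      also have "\<bar>v x\<bar> / (2 ^ N * l) / (\<bar>v x\<bar> / l) = 1 / 2 ^ N"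
        using False l by simp
      also have "(1 / 2 ^ N) powr p * rphi (\<bar>v x\<bar> / l) \<le> (1 / 2 ^ N) powr 1 * rphi (B / l)"
        using p_ge_1 bdd l
        by (intro mult_mono powr_mono' monoD[OF mono_rphi] divide_right_mono) auto
      finally show ?thesis by simp
    qed simp
    have "(\<integral>\<^sup>+ x. ennreal (rphi (\<bar>v x\<bar> / (2 ^ N * l))) \<partial>lebesgue)
      \<le> (\<integral>\<^sup>+ x. ennreal (rphi (B / l) / 2 ^ N) * indicator {x. v x \<noteq> 0} x \<partial>lebesgue)"
      using pt by (intro nn_integral_mono) (auto simp: indicator_def intro: ennreal_leI)
    also have "\<dots> = ennreal (rphi (B / l) / 2 ^ N * m)"
      using S m by (simp add: nn_integral_cmult_indicator flip: ennreal_mult)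
    also have "\<dots> \<le> ennreal 1"
      using N by (intro ennreal_leI) (simp add: field_simps)
    finally show ?thesis by (simp add: P_def)
  qed
  with nP0 obtain k where k: "\<not> P k" "P (Suc k)"
    using ex_least_nat_less[of P N] by auto
  define \<mu> where "\<mu> = 2 ^ Suc k * l"
  have \<mu>: "l \<le> \<mu>" "0 < \<mu>"
    unfolding \<mu>_def using l mult_right_mono[of 1 "2 ^ Suc k" l] by (auto simp del: power_Suc)
  \<comment> \<open>\<open>4 / (2 * \<mu>)\<close> is the reciprocal of the previous scale
    \<open>2 ^ k * l\<close>, where the modular bound failed.\<close>
  have nk: "1 \<le> (\<integral>\<^sup>+ x. ennreal (rphi (4 * (\<bar>v x\<bar> / (2 * \<mu>)))) \<partial>lebesgue)"
  proof -
    have "4 * (a / (2 * \<mu>)) = a / (2 ^ k * l)" for a using l by (simp add: \<mu>_def field_simps)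
    then show ?thesis using k(1) by (simp add: P_def)
  qed
  have "ennreal (l powr p * \<kappa>) \<le> ennreal (\<mu> powr p * \<kappa>)"
    using l \<mu> \<kappa> p_ge_1 by (intro ennreal_leI mult_right_mono powr_mono2) auto
  also have "\<dots> = ennreal (\<mu> powr p) * (ennreal \<kappa> * 1)"
    using \<kappa> by (simp add: ennreal_mult)
  also have "\<dots> \<le> ennreal (\<mu> powr p) * (ennreal \<kappa> * (\<integral>\<^sup>+ x. ennreal (rphi (4 * (\<bar>v x\<bar> / (2 * \<mu>)))) \<partial>lebesgue))"
    using nk by (intro mult_left_mono) auto
  also have "\<dots> = ennreal (\<mu> powr p) * (\<integral>\<^sup>+ x. ennreal (\<kappa> * rphi (4 * (\<bar>v x\<bar> / (2 * \<mu>)))) \<partial>lebesgue)"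
    using \<kappa> by (simp add: ennreal_mult nn_integral_cmult)
  also have "\<dots> \<le> ennreal (\<mu> powr p) * (\<integral>\<^sup>+ x. ennreal (rphi (\<bar>v x\<bar> / (2 * \<mu>))) \<partial>lebesgue)"
    using \<mu> by (intro mult_left_mono nn_integral_mono ennreal_leI \<kappa>) auto
  also have "\<dots> \<le> energy p \<nu> UNIV v"
    using k(2) \<mu> by (intro modular_le_energy v) (simp_all add: P_def \<mu>_def)
  finally show False using small by simp
qed

text \<open>Approximation by bounded functions with supports of finite measure and no larger energy,
  followed by Fatou's lemma.\<close>

lemma modular_le_1:
  assumes v: "v \<in> Lp_space p UNIV" and l: "0 < l"
    and \<kappa>: "0 < \<kappa>" "\<And>t. 0 \<le> t \<Longrightarrow> \<kappa> * rphi (4 * t) \<le> rphi t"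
    and small: "energy p \<nu> UNIV v < ennreal (l powr p * \<kappa>)"
  shows "(\<integral>\<^sup>+ x. ennreal (rphi (\<bar>v x\<bar> / (2 * l))) \<partial>lebesgue) \<le> 1"
proof -
  have vm [measurable]: "v \<in> borel_measurable lebesgue"
    and vp: "(\<integral>\<^sup>+ x. ennreal (\<bar>v x\<bar> powr p) \<partial>lebesgue) < top"
    using v by (simp_all add: Lp_space_def lebesgue_on_UNIV_eq)
  define d where "d n = 1 / real (Suc n)" for n
  have d: "0 < d n" for n by (simp add: d_def)
  \<comment> \<open>The inner soft threshold removes values of size at most \<open>d n\<close>, so
    Chebyshev's inequality in \<open>L^p\<close> controls the support; the outer truncation bounds
    the function.\<close>
  define T where "T n t = truncate (real n) (t - truncate (d n) t)" for n t
  have [measurable]: "T n \<in> borel_measurable borel" for n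
    unfolding T_def[abs_def] by measurable
  have T0: "t \<noteq> 0 \<and> \<bar>t\<bar> > d n" if "T n t \<noteq> 0" for n t
    using that d[of n] by (force simp: T_def truncate_eq_self not_less[symmetric] truncate_def)
  have bound: "(\<integral>\<^sup>+ x. ennreal (rphi (\<bar>T n (v x)\<bar> / l)) \<partial>lebesgue) \<le> 1" for n
  proof (rule modular_le_1_bounded[OF _ l _ _ \<kappa>])
    show "(\<lambda>x. T n (v x)) \<in> borel_measurable lebesgue" by measurable
    show "\<bar>T n (v x)\<bar> \<le> real n" for x by (simp add: T_def abs_truncate_le)
    have "energy p \<nu> UNIV (\<lambda>x. T n (v x)) \<le> energy p \<nu> UNIV v"
    proof (rule energy_mono_Lipschitz[OF p_ge_1 kernel_nonneg])
      show "\<bar>T n (v x) - T n (v y)\<bar> \<le> \<bar>v x - v y\<bar>" for x y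
        unfolding T_def using d[of n]
        by (intro order.trans[OF truncate_Lipschitz diff_truncate_Lipschitz]) simp
    qed
    then show "energy p \<nu> UNIV (\<lambda>x. T n (v x)) < ennreal (l powr p * \<kappa>)"
      using small by simp
    have m: "{x. T n (v x) \<noteq> 0} \<in> sets lebesgue"
    proof -
      have "Measurable.pred lebesgue (\<lambda>x. T n (v x) \<noteq> 0)" by measurable
      then show ?thesis by (simp add: pred_def)
    qed
    have "ennreal (d n powr p) * emeasure lebesgue {x. T n (v x) \<noteq> 0}
        = (\<integral>\<^sup>+ x. ennreal (d n powr p) * indicator {x. T n (v x) \<noteq> 0} x \<partial>lebesgue)"
      using m by (simp add: nn_integral_cmult_indicator)
    also have "\<dots> \<le> (\<integral>\<^sup>+ x. ennreal (\<bar>v x\<bar> powr p) \<partial>lebesgue)"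
    proof (rule nn_integral_mono)
      fix x
      show "ennreal (d n powr p) * indicator {x. T n (v x) \<noteq> 0} x \<le> ennreal (\<bar>v x\<bar> powr p)"
      proof (cases "T n (v x) = 0")
        case False
        then have "d n \<le> \<bar>v x\<bar>" using T0 by (meson less_imp_le)
        then have "d n powr p \<le> \<bar>v x\<bar> powr p"
          using p_ge_1 d[of n] by (intro powr_mono2) auto
        with False show ?thesis by (simp add: ennreal_leI)
      qed simp
    qed
    also note vp
    finally have "emeasure lebesgue {x. T n (v x) \<noteq> 0} \<noteq> top"
      using d[of n] by (auto simp: ennreal_mult_top)
    then show "emeasure lebesgue {x. T n (v x) \<noteq> 0} < top" by (simp add: less_top)
  qed
  have lim: "(\<lambda>n. T n t) \<longlonglongrightarrow> t" for t
  proof (rule Lim_transform_eventually)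
    have "(\<lambda>n. truncate (d n) t) \<longlonglongrightarrow> 0"
    proof (rule Lim_null_comparison)
      show "\<forall>\<^sub>F n in sequentially. norm (truncate (d n) t) \<le> d n"
        using d by (intro always_eventually allI) (simp add: abs_truncate_le less_imp_le)
      show "d \<longlonglongrightarrow> 0"
        using LIMSEQ_inverse_real_of_nat by (simp add: d_def[abs_def] inverse_eq_divide)
    qed
    then have "(\<lambda>n. t - truncate (d n) t) \<longlonglongrightarrow> t - 0" by (intro tendsto_intros)
    then show "(\<lambda>n. t - truncate (d n) t) \<longlonglongrightarrow> t" by simp
    show "\<forall>\<^sub>F n in sequentially. t - truncate (d n) t = T n t"
      using eventually_ge_at_top[of "nat \<lceil>\<bar>t\<bar>\<rceil>"]
    proof eventually_elim
      case (elim n)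
      have "\<bar>t - truncate (d n) t\<bar> \<le> \<bar>t\<bar>"
        using d[of n] by (auto simp: truncate_def max_def min_def)
      with elim show ?case unfolding T_def by (subst truncate_eq_self) linarith+
    qed
  qed
  \<comment> \<open>The factor \<open>2\<close> lets monotonicity replace continuity of
    \<open>rphi\<close>: eventually \<open>\<bar>T n t\<bar>\<close> exceeds
    \<open>\<bar>t\<bar> / 2\<close>.\<close>
  have "ennreal (rphi (\<bar>t\<bar> / (2 * l))) \<le> liminf (\<lambda>n. ennreal (rphi (\<bar>T n t\<bar> / l)))" for t
  proof (cases "t = 0")
    case False
    have "(\<lambda>n. \<bar>T n t\<bar>) \<longlonglongrightarrow> \<bar>t\<bar>" by (intro tendsto_intros lim)
    then have "\<forall>\<^sub>F n in sequentially. \<bar>t\<bar> / 2 < \<bar>T n t\<bar>"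
      using False by (intro order_tendstoD(1)) auto
    then have "\<forall>\<^sub>F n in sequentially. ennreal (rphi (\<bar>t\<bar> / (2 * l))) \<le> ennreal (rphi (\<bar>T n t\<bar> / l))"
      by eventually_elim (use l in \<open>auto intro!: ennreal_leI monoD[OF mono_rphi] simp: field_simps\<close>)
    then show ?thesis by (rule Liminf_bounded)
  qed simp
  then have "(\<integral>\<^sup>+ x. ennreal (rphi (\<bar>v x\<bar> / (2 * l))) \<partial>lebesgue)
    \<le> (\<integral>\<^sup>+ x. liminf (\<lambda>n. ennreal (rphi (\<bar>T n (v x)\<bar> / l))) \<partial>lebesgue)"
    by (intro nn_integral_mono)
  also have "\<dots> \<le> liminf (\<lambda>n. \<integral>\<^sup>+ x. ennreal (rphi (\<bar>T n (v x)\<bar> / l)) \<partial>lebesgue)"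
    by (rule nn_integral_liminf) measurable
  also have "\<dots> \<le> 1"
    using bound by (intro Liminf_le) auto
  finally show ?thesis .
qed

end

section \<open>Inequalities on a set of finite measure\<close>

locale sobolev_domain = sobolev_kernel \<nu> p for \<nu> :: "'a::euclidean_space \<Rightarrow> real" and p +
  fixes \<Omega> :: "'a set"
  assumes dom_sets: "\<Omega> \<in> sets lebesgue" and dom_finite: "emeasure lebesgue \<Omega> < top"
begin

sublocale dom: finite_measure "lebesgue_on \<Omega>"
  using dom_sets dom_finite by (intro finite_measureI) (simp add: emeasure_restrict_space)

lemma nn_integral_dom_const: "(\<integral>\<^sup>+ x. ennreal c \<partial>lebesgue_on \<Omega>) = ennreal c * emeasure lebesgue \<Omega>"
  using dom_sets by (simp add: emeasure_restrict_space)

text \<open>Pointwise split at height \<open>c\<close>: below it the scaled power is at most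
  \<open>1\<close>, which integrates to the measure of the set; above it \<open>rphi_scale\<close>
  compares the power with \<open>rphi\<close>.\<close>

lemma nn_integral_powr_le_modular:
  assumes f [measurable]: "f \<in> borel_measurable (lebesgue_on \<Omega>)" and c: "0 < c"
  shows "(\<integral>\<^sup>+ x. ennreal (\<bar>f x\<bar> powr p) \<partial>lebesgue_on \<Omega>)
    \<le> ennreal (c powr p) * (emeasure lebesgue \<Omega>
        + ennreal (1 / rphi 1) * (\<integral>\<^sup>+ x. ennreal (rphi (\<bar>f x\<bar> / c)) \<partial>lebesgue_on \<Omega>))"
proof -
  have r1: "0 < rphi 1" by (rule rphi_pos) simp
  have "\<bar>t\<bar> powr p \<le> c powr p * (1 + 1 / rphi 1 * rphi (\<bar>t\<bar> / c))" for t
  proof -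
    have "(\<bar>t\<bar> / c) powr p \<le> 1 + 1 / rphi 1 * rphi (\<bar>t\<bar> / c)"
    proof (cases "\<bar>t\<bar> / c \<le> 1")
      case True
      then have "(\<bar>t\<bar> / c) powr p \<le> 1" using c p_ge_1 by (intro powr_le1) auto
      moreover have "0 \<le> 1 / rphi 1 * rphi (\<bar>t\<bar> / c)" by simp
      ultimately show ?thesis by linarith
    next
      case False
      define s where "s = \<bar>t\<bar> / c"
      have s: "1 < s" using False by (simp add: s_def)
      have "rphi 1 \<le> (1 / s) powr p * rphi s" using s by (intro rphi_scale) auto
      then have "s powr p \<le> 1 / rphi 1 * rphi s"
        using s r1 by (simp add: powr_divide field_simps)
      then show ?thesis by (simp flip: s_def)
    qed
    then have "c powr p * (\<bar>t\<bar> / c) powr p \<le> c powr p * (1 + 1 / rphi 1 * rphi (\<bar>t\<bar> / c))"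
      by (intro mult_left_mono) auto
    then show ?thesis using c by (simp add: powr_divide)
  qed
  then have "(\<integral>\<^sup>+ x. ennreal (\<bar>f x\<bar> powr p) \<partial>lebesgue_on \<Omega>)
    \<le> (\<integral>\<^sup>+ x. ennreal (c powr p) * (ennreal 1 + ennreal (1 / rphi 1) * ennreal (rphi (\<bar>f x\<bar> / c))) \<partial>lebesgue_on \<Omega>)"
    by (intro nn_integral_mono) (simp add: ennreal_leI del: ennreal_1 flip: ennreal_mult ennreal_plus)
  also have "\<dots> = ennreal (c powr p) * ((\<integral>\<^sup>+ x. ennreal 1 \<partial>lebesgue_on \<Omega>)
      + ennreal (1 / rphi 1) * (\<integral>\<^sup>+ x. ennreal (rphi (\<bar>f x\<bar> / c)) \<partial>lebesgue_on \<Omega>))"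
    by (simp add: nn_integral_cmult nn_integral_add)
  also have "(\<integral>\<^sup>+ x. ennreal 1 \<partial>lebesgue_on \<Omega>) = emeasure lebesgue \<Omega>"
    by (simp only: nn_integral_dom_const) simp
  finally show ?thesis .
qed

lemma orlicz_subset_Lp: "orlicz_space (phi p \<nu>) \<Omega> \<subseteq> Lp_space p \<Omega>"
proof
  fix u assume "u \<in> orlicz_space (phi p \<nu>) \<Omega>"
  then obtain c where c: "0 < c" and u: "u \<in> borel_measurable (lebesgue_on \<Omega>)"
    and fin: "(\<integral>\<^sup>+ x. ennreal (rphi (\<bar>u x\<bar> / c)) \<partial>lebesgue_on \<Omega>) < top"
    by (auto simp: orlicz_space_def phi_eq_rphi)
  have "ennreal (c powr p) * (emeasure lebesgue \<Omega>
        + ennreal (1 / rphi 1) * (\<integral>\<^sup>+ x. ennreal (rphi (\<bar>u x\<bar> / c)) \<partial>lebesgue_on \<Omega>)) < top"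
    using fin dom_finite by (simp add: ennreal_mult_less_top)
  with nn_integral_powr_le_modular[OF u c] u show "u \<in> Lp_space p \<Omega>"
    by (auto simp: Lp_space_def)
qed

lemma Lp_norm_le_luxemburg_norm:
  obtains K where "0 < K"
    "\<And>f. f \<in> borel_measurable (lebesgue_on \<Omega>) \<Longrightarrow>
       Lp_norm p \<Omega> f \<le> ennreal K * luxemburg_norm (phi p \<nu>) \<Omega> f"
proof -
  define m where "m = measure lebesgue \<Omega>"
  have m: "0 \<le> m" "emeasure lebesgue \<Omega> = ennreal m"
    using dom_finite by (auto simp: m_def emeasure_eq_ennreal_measure less_top)
  have r1: "0 < rphi 1" by (rule rphi_pos) simp
  have m1: "0 < m + 1 / rphi 1" using m r1 by (simp add: add_nonneg_pos)
  \<comment> \<open>The \<open>p\<close>-th power of \<open>K\<close> is the constant of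
    \<open>nn_integral_powr_le_modular\<close> when the modular is at most \<open>1\<close>.\<close>
  define K where "K = (m + 1 / rphi 1) powr (1 / p)"
  have K: "0 < K" using m1 by (simp add: K_def)
  have Kp: "K powr p = m + 1 / rphi 1"
    using m1 p_ge_1 by (simp add: K_def powr_powr)
  have "Lp_norm p \<Omega> f \<le> ennreal K * luxemburg_norm (phi p \<nu>) \<Omega> f"
    if f: "f \<in> borel_measurable (lebesgue_on \<Omega>)" for f
  proof -
    have "Lp_norm p \<Omega> f / ennreal K \<le> luxemburg_norm (phi p \<nu>) \<Omega> f"
      unfolding luxemburg_norm_def
    proof (rule Inf_greatest, clarsimp simp: phi_eq_rphi)
      fix c assume c: "0 < c" and mod: "(\<integral>\<^sup>+ x. ennreal (rphi (\<bar>f x\<bar> / c)) \<partial>lebesgue_on \<Omega>) \<le> 1"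
      have "(\<integral>\<^sup>+ x. ennreal (\<bar>f x\<bar> powr p) \<partial>lebesgue_on \<Omega>)
        \<le> ennreal (c powr p) * (emeasure lebesgue \<Omega>
            + ennreal (1 / rphi 1) * (\<integral>\<^sup>+ x. ennreal (rphi (\<bar>f x\<bar> / c)) \<partial>lebesgue_on \<Omega>))"
        by (rule nn_integral_powr_le_modular[OF f c])
      also have "\<dots> \<le> ennreal (c powr p) * (ennreal m + ennreal (1 / rphi 1) * 1)"
        unfolding m(2) using mod by (intro mult_left_mono add_left_mono) auto
      also have "\<dots> = ennreal ((K * c) powr p) * 1"
        using m c K r1 by (simp add: powr_mult Kp mult.commute flip: ennreal_mult ennreal_plus)
      finally have "Lp_norm p \<Omega> f \<le> ennreal (K * c) * epowr 1 (1 / p)"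
        unfolding Lp_norm_def using K c p_ge_1 by (subst epowr_le_cmult_iff) auto
      also have "epowr 1 (1 / p) = 1" by (simp add: epowr_def)
      finally show "Lp_norm p \<Omega> f / ennreal K \<le> ennreal c"
        using K c by (intro divide_le_posI_ennreal) (auto simp: ennreal_mult)
    qed
    then have "ennreal K * (Lp_norm p \<Omega> f / ennreal K) \<le> ennreal K * luxemburg_norm (phi p \<nu>) \<Omega> f"
      by (rule mult_left_mono) simp
    then show ?thesis
      using K by (simp add: ennreal_times_divide ennreal_mult_divide_eq mult.commute[of "ennreal K" "Lp_norm p \<Omega> f"])
  qed
  with K show ?thesis by (rule that)
qed

lemma poincare_iff:
  "poincare p \<nu> \<Omega> \<longleftrightarrow> (\<exists>D>0. \<forall>u\<in>Lp_space p \<Omega>.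
     (\<integral>\<^sup>+ x. ennreal (\<bar>u x - mean \<Omega> u\<bar> powr p) \<partial>lebesgue_on \<Omega>) \<le> ennreal D * energy p \<nu> \<Omega> u)"
  (is "_ \<longleftrightarrow> (\<exists>D>0. ?P D)")
proof
  assume "poincare p \<nu> \<Omega>"
  then obtain C where "C > 0" "?P (C powr p)"
    unfolding poincare_def Lp_norm_def using p_ge_1 by (auto simp: epowr_le_cmult_iff)
  then show "\<exists>D>0. ?P D" by (intro exI[of _ "C powr p"]) auto
next
  assume "\<exists>D>0. ?P D"
  then obtain D where D: "D > 0" "?P D" by blast
  then have "?P ((D powr (1 / p)) powr p)" using p_ge_1 by (simp add: powr_powr)
  with D show "poincare p \<nu> \<Omega>"
    unfolding poincare_def Lp_norm_def using p_ge_1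
    by (intro exI[of _ "D powr (1 / p)"]) (simp add: epowr_le_cmult_iff)
qed

text \<open>Constants are integrable on a set of finite measure, and
  \<open>\<bar>t\<bar> \<le> 1 + \<bar>t\<bar> powr p\<close>. This supplies the dominating function
  for the means of truncations.\<close>

lemma integrable_Lp:
  assumes "u \<in> Lp_space p \<Omega>"
  shows "integrable (lebesgue_on \<Omega>) u"
proof (rule integrableI_bounded)
  show u [measurable]: "u \<in> borel_measurable (lebesgue_on \<Omega>)" using assms by (simp add: Lp_space_def)
  have "\<bar>t\<bar> \<le> 1 + \<bar>t\<bar> powr p" for t :: real
  proof (cases "\<bar>t\<bar> \<le> 1")
    case False
    then have "\<bar>t\<bar> powr 1 \<le> \<bar>t\<bar> powr p" using p_ge_1 by (intro powr_mono) auto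
    with False show ?thesis by simp
  qed (simp add: add_increasing2)
  then have "(\<integral>\<^sup>+ x. ennreal (norm (u x)) \<partial>lebesgue_on \<Omega>)
      \<le> (\<integral>\<^sup>+ x. ennreal 1 + ennreal (\<bar>u x\<bar> powr p) \<partial>lebesgue_on \<Omega>)"
    by (intro nn_integral_mono) (simp add: ennreal_leI del: ennreal_1 flip: ennreal_plus)
  also have "\<dots> = (\<integral>\<^sup>+ x. ennreal 1 \<partial>lebesgue_on \<Omega>) + (\<integral>\<^sup>+ x. ennreal (\<bar>u x\<bar> powr p) \<partial>lebesgue_on \<Omega>)"
    by (rule nn_integral_add) auto
  also have "\<dots> < \<infinity>"
    using assms dom_finite unfolding nn_integral_dom_const by (simp add: Lp_space_def less_top)
  finally show "(\<integral>\<^sup>+ x. ennreal (norm (u x)) \<partial>lebesgue_on \<Omega>) < \<infinity>" .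
qed

lemma poincare_sobolev_imp_poincare:
  assumes "poincare_sobolev p \<nu> \<Omega>"
  shows "poincare p \<nu> \<Omega>"
proof -
  obtain C where C: "C > 0" and PS: "\<And>u. u \<in> orlicz_space (phi p \<nu>) \<Omega> \<Longrightarrow>
        luxemburg_norm (phi p \<nu>) \<Omega> (\<lambda>x. u x - mean \<Omega> u) \<le> ennreal C * epowr (energy p \<nu> \<Omega> u) (1 / p)"
    using assms unfolding poincare_sobolev_def by blast
  obtain K where K: "0 < K" and KL: "\<And>f. f \<in> borel_measurable (lebesgue_on \<Omega>) \<Longrightarrow>
       Lp_norm p \<Omega> f \<le> ennreal K * luxemburg_norm (phi p \<nu>) \<Omega> f"
    using Lp_norm_le_luxemburg_norm by blast
  define D where "D = (K * C) powr p"
  have orl: "(\<integral>\<^sup>+ x. ennreal (\<bar>u x - mean \<Omega> u\<bar> powr p) \<partial>lebesgue_on \<Omega>) \<le> ennreal D * energy p \<nu> \<Omega> u"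
    if u: "u \<in> orlicz_space (phi p \<nu>) \<Omega>" for u
  proof -
    have [measurable]: "u \<in> borel_measurable (lebesgue_on \<Omega>)" using u by (simp add: orlicz_space_def)
    have "Lp_norm p \<Omega> (\<lambda>x. u x - mean \<Omega> u)
        \<le> ennreal K * luxemburg_norm (phi p \<nu>) \<Omega> (\<lambda>x. u x - mean \<Omega> u)"
      by (rule KL) measurable
    also have "\<dots> \<le> ennreal K * (ennreal C * epowr (energy p \<nu> \<Omega> u) (1 / p))"
      by (intro mult_left_mono PS u) simp
    also have "\<dots> = ennreal (K * C) * epowr (energy p \<nu> \<Omega> u) (1 / p)"
      using K C by (simp add: ennreal_mult mult.assoc)
    finally show ?thesis
      unfolding Lp_norm_def D_def using K C p_ge_1 by (subst (asm) epowr_le_cmult_iff) auto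
  qed
  have "(\<integral>\<^sup>+ x. ennreal (\<bar>u x - mean \<Omega> u\<bar> powr p) \<partial>lebesgue_on \<Omega>) \<le> ennreal D * energy p \<nu> \<Omega> u"
    if u: "u \<in> Lp_space p \<Omega>" for u
  proof -
    have um [measurable]: "u \<in> borel_measurable (lebesgue_on \<Omega>)" using u by (simp add: Lp_space_def)
    define T where "T n x = truncate (real n) (u x)" for n x
    have [measurable]: "T n \<in> borel_measurable (lebesgue_on \<Omega>)" for n
      unfolding T_def[abs_def] by measurable
    \<comment> \<open>A bounded function has finite modular on a set of finite measure.\<close>
    have T_orlicz: "T n \<in> orlicz_space (phi p \<nu>) \<Omega>" for n
    proof -
      have "(\<integral>\<^sup>+ x. ennreal (rphi (\<bar>T n x\<bar> / 1)) \<partial>lebesgue_on \<Omega>)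
          \<le> (\<integral>\<^sup>+ x. ennreal (rphi (real n)) \<partial>lebesgue_on \<Omega>)"
        by (intro nn_integral_mono ennreal_leI monoD[OF mono_rphi]) (simp add: T_def abs_truncate_le)
      also have "\<dots> < top"
        unfolding nn_integral_dom_const using dom_finite by (simp add: ennreal_mult_less_top)
      finally show ?thesis unfolding orlicz_space_def phi_eq_rphi
        by (intro CollectI conjI exI[of _ 1]) auto
    qed
    have Tn: "(\<integral>\<^sup>+ x. ennreal (\<bar>T n x - mean \<Omega> (T n)\<bar> powr p) \<partial>lebesgue_on \<Omega>) \<le> ennreal D * energy p \<nu> \<Omega> u" for n
    proof -
      have "energy p \<nu> \<Omega> (T n) \<le> energy p \<nu> \<Omega> u"
        by (rule energy_mono_Lipschitz[OF p_ge_1 kernel_nonneg]) (auto simp: T_def truncate_Lipschitz)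
      then show ?thesis
        by (intro order.trans[OF orl mult_left_mono] T_orlicz) auto
    qed
    have lim: "(\<lambda>n. T n x) \<longlonglongrightarrow> u x" for x unfolding T_def by (rule tendsto_truncate)
    \<comment> \<open>The subtracted means vary with \<open>n\<close>, so they must converge before
      Fatou's lemma can be applied.\<close>
    have "(\<lambda>n. \<integral> x. T n x \<partial>lebesgue_on \<Omega>) \<longlonglongrightarrow> (\<integral> x. u x \<partial>lebesgue_on \<Omega>)"
    proof (rule integral_dominated_convergence)
      show "integrable (lebesgue_on \<Omega>) (\<lambda>x. \<bar>u x\<bar>)" by (intro integrable_abs integrable_Lp u)
    qed (use lim in \<open>auto simp: T_def abs_truncate_le_abs\<close>)
    then have "(\<lambda>n. mean \<Omega> (T n)) \<longlonglongrightarrow> mean \<Omega> u" unfolding mean_def by (intro tendsto_intros)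
    with lim have limd: "(\<lambda>n. ennreal (\<bar>T n x - mean \<Omega> (T n)\<bar> powr p)) \<longlonglongrightarrow> ennreal (\<bar>u x - mean \<Omega> u\<bar> powr p)" for x
      using p_ge_1 by (intro tendsto_ennrealI tendsto_powr2 tendsto_intros) auto
    have "(\<integral>\<^sup>+ x. ennreal (\<bar>u x - mean \<Omega> u\<bar> powr p) \<partial>lebesgue_on \<Omega>)
      = (\<integral>\<^sup>+ x. liminf (\<lambda>n. ennreal (\<bar>T n x - mean \<Omega> (T n)\<bar> powr p)) \<partial>lebesgue_on \<Omega>)"
      using lim_imp_Liminf[OF sequentially_bot limd] by simp
    also have "\<dots> \<le> liminf (\<lambda>n. \<integral>\<^sup>+ x. ennreal (\<bar>T n x - mean \<Omega> (T n)\<bar> powr p) \<partial>lebesgue_on \<Omega>)"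
      by (rule nn_integral_liminf) measurable
    also have "\<dots> \<le> ennreal D * energy p \<nu> \<Omega> u"
      using Tn by (intro Liminf_le) auto
    finally show ?thesis .
  qed
  moreover have "0 < D" using K C by (simp add: D_def)
  ultimately show ?thesis unfolding poincare_iff by blast
qed

text \<open>Subtracting the mean first makes the Poincare inequality control the full
  \<open>W_norm\<close> by the energy alone, so the extension has energy bounded by that of
  \<open>u\<close>.\<close>

lemma poincare_imp_poincare_sobolev:
  assumes ext: "W_extension_domain p \<nu> \<Omega>" and poi: "poincare p \<nu> \<Omega>"
  shows "poincare_sobolev p \<nu> \<Omega>"
proof -
  obtain E :: "('a \<Rightarrow> real) \<Rightarrow> 'a \<Rightarrow> real" and C where C: "C > 0"
    and E: "\<And>u. u \<in> W_space p \<nu> \<Omega> \<Longrightarrow> E u \<in> W_space p \<nu> UNIV"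
      "\<And>u. u \<in> W_space p \<nu> \<Omega> \<Longrightarrow> AE x in lebesgue_on \<Omega>. E u x = u x"
      "\<And>u. u \<in> W_space p \<nu> \<Omega> \<Longrightarrow> W_norm p \<nu> UNIV (E u) \<le> ennreal C * W_norm p \<nu> \<Omega> u"
    using ext unfolding W_extension_domain_def by blast
  obtain D where D: "D > 0" and PD: "\<And>u. u \<in> Lp_space p \<Omega> \<Longrightarrow>
     (\<integral>\<^sup>+ x. ennreal (\<bar>u x - mean \<Omega> u\<bar> powr p) \<partial>lebesgue_on \<Omega>) \<le> ennreal D * energy p \<nu> \<Omega> u"
    using poi unfolding poincare_iff by blast
  obtain \<kappa> where \<kappa>: "0 < \<kappa>" "\<And>t. 0 \<le> t \<Longrightarrow> \<kappa> * rphi (4 * t) \<le> rphi t"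
    using rphi_doubling by blast
  \<comment> \<open>\<open>B\<close> bounds the energy of the extension relative to that of
    \<open>u\<close>: \<open>D\<close> comes from the \<open>L^p\<close> part and \<open>1\<close>
    from the energy itself. In \<open>A\<close>, the root is the critical scale for
    \<open>modular_le_1\<close> and \<open>2\<close> is the factor lost there.\<close>
  define B where "B = C powr p * (D + 1)"
  have B: "0 < B" using C D by (simp add: B_def)
  define A where "A = 2 * (B / \<kappa>) powr (1 / p)"
  have A: "0 < A" using B \<kappa> by (simp add: A_def)
  have "luxemburg_norm (phi p \<nu>) \<Omega> (\<lambda>x. u x - mean \<Omega> u) \<le> ennreal A * epowr (energy p \<nu> \<Omega> u) (1 / p)"
    if "u \<in> orlicz_space (phi p \<nu>) \<Omega>" for u
  proof (cases "energy p \<nu> \<Omega> u")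
    case top
    then show ?thesis using A by (simp add: ennreal_mult_top)
  next
    case (real e)
    note e = this
    have uL: "u \<in> Lp_space p \<Omega>" using that orlicz_subset_Lp by blast
    have [measurable]: "u \<in> borel_measurable (lebesgue_on \<Omega>)" using uL by (simp add: Lp_space_def)
    define v where "v x = u x - mean \<Omega> u" for x
    have ve: "energy p \<nu> \<Omega> v = ennreal e" using e by (simp add: energy_def v_def)
    have vL: "(\<integral>\<^sup>+ x. ennreal (\<bar>v x\<bar> powr p) \<partial>lebesgue_on \<Omega>) \<le> ennreal (D * e)"
      using PD[OF uL] e D by (simp add: v_def ennreal_mult)
    have "v \<in> borel_measurable (lebesgue_on \<Omega>)" unfolding v_def[abs_def] by measurable
    then have vW: "v \<in> W_space p \<nu> \<Omega>"
      using ve le_less_trans[OF vL ennreal_less_top] by (simp add: W_space_def Lp_space_def)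
    have "(\<integral>\<^sup>+ x. ennreal (\<bar>E v x\<bar> powr p) \<partial>lebesgue) + energy p \<nu> UNIV (E v)
        \<le> ennreal (C powr p) * ((\<integral>\<^sup>+ x. ennreal (\<bar>v x\<bar> powr p) \<partial>lebesgue_on \<Omega>) + energy p \<nu> \<Omega> v)"
      using E(3)[OF vW] C p_ge_1 unfolding W_norm_def by (simp add: epowr_le_cmult_iff lebesgue_on_UNIV_eq)
    also have "\<dots> \<le> ennreal (C powr p) * (ennreal (D * e) + ennreal e)"
      using vL ve by (intro mult_left_mono add_mono) auto
    also have "\<dots> = ennreal (B * e)"
      using e D C by (simp add: B_def algebra_simps flip: ennreal_mult ennreal_plus)
    finally have Ee: "energy p \<nu> UNIV (E v) \<le> ennreal (B * e)"
      by (rule order.trans[rotated]) simp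
    \<comment> \<open>The strict inequality required by \<open>modular_le_1\<close> holds only above
      the critical scale, which is then approached from above; this also covers zero energy.\<close>
    have lux: "luxemburg_norm (phi p \<nu>) \<Omega> v \<le> ennreal (2 * l)"
      if l: "(B * e / \<kappa>) powr (1 / p) < l" for l
    proof -
      have l0: "0 < l" by (rule le_less_trans[OF _ l]) simp
      have "((B * e / \<kappa>) powr (1 / p)) powr p < l powr p"
        using l p_ge_1 by (intro powr_less_mono2) auto
      then have "B * e < l powr p * \<kappa>"
        using B e \<kappa> p_ge_1 by (simp add: powr_powr pos_divide_less_eq)
      then have "energy p \<nu> UNIV (E v) < ennreal (l powr p * \<kappa>)"
        using B e by (intro le_less_trans[OF Ee]) (simp add: ennreal_less_iff)
      then have mod: "(\<integral>\<^sup>+ x. ennreal (rphi (\<bar>E v x\<bar> / (2 * l))) \<partial>lebesgue) \<le> 1"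
        using E(1)[OF vW] l0 \<kappa> by (intro modular_le_1[of _ _ \<kappa>]) (auto simp: W_space_def)
      have "(\<integral>\<^sup>+ x. ennreal (rphi (\<bar>v x\<bar> / (2 * l))) \<partial>lebesgue_on \<Omega>)
          = (\<integral>\<^sup>+ x. ennreal (rphi (\<bar>E v x\<bar> / (2 * l))) \<partial>lebesgue_on \<Omega>)"
        using E(2)[OF vW] by (intro nn_integral_cong_AE) auto
      also have "\<dots> = (\<integral>\<^sup>+ x. ennreal (rphi (\<bar>E v x\<bar> / (2 * l))) * indicator \<Omega> x \<partial>lebesgue)"
        using dom_sets by (intro nn_integral_restrict_space) simp
      also have "\<dots> \<le> (\<integral>\<^sup>+ x. ennreal (rphi (\<bar>E v x\<bar> / (2 * l))) \<partial>lebesgue)"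
        by (intro nn_integral_mono) (simp add: indicator_def)
      also note mod
      finally show ?thesis
        unfolding luxemburg_norm_def using l0 by (intro Inf_lower CollectI exI[of _ "2 * l"]) (simp add: phi_eq_rphi)
    qed
    have "luxemburg_norm (phi p \<nu>) \<Omega> v \<le> ennreal (2 * (B * e / \<kappa>) powr (1 / p))"
    proof (rule ennreal_le_epsilon)
      fix \<epsilon> :: real assume "0 < \<epsilon>"
      then have "luxemburg_norm (phi p \<nu>) \<Omega> v \<le> ennreal (2 * ((B * e / \<kappa>) powr (1 / p) + \<epsilon> / 2))"
        by (intro lux) simp
      then show "luxemburg_norm (phi p \<nu>) \<Omega> v \<le> ennreal (2 * (B * e / \<kappa>) powr (1 / p)) + ennreal \<epsilon>"
        using \<open>0 < \<epsilon>\<close> by (simp add: algebra_simps flip: ennreal_plus)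
    qed
    also have "\<dots> = ennreal A * epowr (energy p \<nu> \<Omega> u) (1 / p)"
      using e B \<kappa> A powr_mult[of "B / \<kappa>" e "1 / p"] by (simp add: A_def epowr_ennreal flip: ennreal_mult)
    finally show ?thesis by (simp add: v_def[abs_def])
  qed
  with A show ?thesis unfolding poincare_sobolev_def by blast
qed

end

theorem theorem4p3:
  fixes \<nu> :: "'a::euclidean_space \<Rightarrow> real" and p :: real and \<Omega> :: "'a set"
  assumes "1 \<le> p"
    and "\<nu> \<in> borel_measurable (lebesgue_on (- {0}))"
    and "\<And>h. h \<noteq> 0 \<Longrightarrow> 0 \<le> \<nu> h"
    and "potential_invertible p \<nu>"
    and "young_function (\<lambda>t. phi p \<nu> (epowr t (1 / p)))"
    and "\<exists>\<theta>::real. \<theta> > 0 \<and> (\<forall>s t::real. 0 \<le> s \<and> s \<le> t \<and> 0 < t \<longrightarrow>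
           phi p \<nu> (ennreal (\<theta> * s / t)) \<le> phi p \<nu> (ennreal s) / phi p \<nu> (ennreal t))"
    and "\<Omega> \<in> sets lebesgue"
    and "0 < emeasure lebesgue \<Omega>" and "emeasure lebesgue \<Omega> < top"
  shows "(poincare_sobolev p \<nu> \<Omega> \<longrightarrow> poincare p \<nu> \<Omega>) \<and>
    (W_extension_domain p \<nu> \<Omega> \<longrightarrow> poincare p \<nu> \<Omega> \<longrightarrow> poincare_sobolev p \<nu> \<Omega>)"
proof -
  interpret sobolev_domain \<nu> p \<Omega>
    by unfold_locales (use assms in auto)
  show ?thesis
    using poincare_sobolev_imp_poincare poincare_imp_poincare_sobolev by blast
qed

end
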